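(* Let $s,t$ be step sequences over a g-comtrace alphabet $(E,sim,ser,inl)$. Then $s\equiv t$ if and only if $G^{\{s\}}=G^{\{t\}}$.
   Context: Relations: for $R$ on $X$, $R^{-1}$ inverse, $R^*=\bigcup_{i\ge0}R^i$ ($R^0=\mathrm{id}_X$), $R\circ S=\{(x,y):\exists z.\,xRz\wedge zSy\}$, $R^{\mathrm{sym}}=R\cup R^{-1}$, $R^{\Cap}=R\cap R^{-1}$, $R^C=(X\times X)\setminus R$. A g-comtrace alphabet is $(E,sim,ser,inl)$ with $E$ finite, $sim,inl\subseteq E\times E$ irreflexive and symmetric, $ser\subseteq sim$, $sim\cap inl=\emptyset$. Steps $\mathbb{S}$: nonempty $A\subseteq E$ with $(a,b)\in sim$ for all distinct $a,b\in A$; step sequences: elements of $\mathbb{S}^*$. $\equiv$ is the reflexive symmetric transitive closure of the pairs $(wAz,wBCz)$ ($w,z\in\mathbb{S}^*$, $A,B,C\in\mathbb{S}$, $A=B\cup C$, $B\times C\subseteq ser$) and $(wABz,wBAz)$ ($A,B\in\mathbb{S}$, $A\times B\subseteq inl$). For $s=A_1\dots A_k$: $\overline{A_i}=\{e^{(m+1)}:e\in A_i\}$ where $m$ is the number of $j<i$ with $e\in A_j$; $\Sigma_s=\bigcup_i\overline{A_i}$; $l(e^{(j)})=e$; $pos_s(\alpha)=i$ iff $\alpha\in\overline{A_i}$; $\alpha\lhd_s\beta$ iff $pos_s(\alpha)<pos_s(\beta)$; $\alpha\lhd_s^\frown\beta$ iff $\alpha\ne\beta\wedge pos_s(\alpha)\le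 pos_s(\beta)$. Closures: $(X,R_1,R_2)^\lozenge=(X,\prec_{R_1,R_2},\sqsubset_{R_1,R_2})$ with $\prec_{R_1,R_2}=(R_1\cup R_2)^*\circ R_1\circ(R_1\cup R_2)^*$, $\sqsubset_{R_1,R_2}=(R_1\cup R_2)^*\setminus\mathrm{id}_X$; for $R_3=R_1\cap R_2^*$, $(X,R_1,R_2)^{\bowtie}=(X,(\prec_{R_3,R_2})^{\mathrm{sym}}\cup R_1,\sqsubset_{R_3,R_2})$. On $\Sigma_s$: $\alpha<\!\!>_s\beta$ iff $(l(\alpha),l(\beta))\in inl$; $\alpha\sqsubset_s\beta$ iff $\alpha\lhd_s^\frown\beta$ and $(l(\beta),l(\alpha))\notin ser\cup inl$; $\alpha\prec_s\beta$ iff $\alpha\lhd_s\beta$ and one of: (i) $(l(\alpha),l(\beta))\notin ser\cup inl$; (ii) $(\alpha,\beta)\in<\!\!>_s\cap((\sqsubset_s^* )^{\Cap}\circ(<\!\!>_s)^C\circ(\sqsubset_s^* )^{\Cap})$; (iii) $(l(\alpha),l(\beta))\in ser$ and there are $\delta,\gamma\in\Sigma_s$ with $\delta\lhd_s\gamma$, $(l(\delta),l(\gamma))\notin ser$, $\alpha\sqsubset_s^*\delta\sqsubset_s^*\beta$, $\alpha\sqsubset_s^*\gamma\sqsubset_s^*\beta$. $G^{\{s\}}=(\Sigma_s,\prec_s\cup<\!\!>_s,\prec_s\cup\sqsubset_s)^{\bowtie}$. *)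

theory Defs
  imports Main
begin

section \<open>Generalized comtraces\<close>

locale gcomtrace_alphabet =
  fixes E :: "'a set"
    and sim ser inl :: "'a rel"
  assumes finite_E: "finite E"
    and sim_on: "sim \<subseteq> E \<times> E"
    and inl_on: "inl \<subseteq> E \<times> E"
    and irrefl_sim: "irrefl sim"
    and irrefl_inl: "irrefl inl"
    and sym_sim: "sym sim"
    and sym_inl: "sym inl"
    and ser_sim: "ser \<subseteq> sim"
    and sim_inl_disjoint: "sim \<inter> inl = {}"

definition steps :: "'a set \<Rightarrow> 'a rel \<Rightarrow> 'a set set" where
  "steps E sim = {A. A \<noteq> {} \<and> A \<subseteq> E \<and> (\<forall>a\<in>A. \<forall>b\<in>A. a \<noteq> b \<longrightarrow> (a, b) \<in> sim)}"

definition step_seqs :: "'a set \<Rightarrow> 'a rel \<Rightarrow> 'a set list set" where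
  "step_seqs E sim = lists (steps E sim)"

inductive gct_rewrite ::
  "'a set \<Rightarrow> 'a rel \<Rightarrow> 'a rel \<Rightarrow> 'a rel \<Rightarrow> 'a set list \<Rightarrow> 'a set list \<Rightarrow> bool"
  for E sim ser inl where
  serialize: "\<lbrakk>w \<in> step_seqs E sim; z \<in> step_seqs E sim;
      A \<in> steps E sim; B \<in> steps E sim; C \<in> steps E sim; A = B \<union> C; B \<times> C \<subseteq> ser\<rbrakk>
    \<Longrightarrow> gct_rewrite E sim ser inl (w @ [A] @ z) (w @ [B, C] @ z)"
| interleave: "\<lbrakk>w \<in> step_seqs E sim; z \<in> step_seqs E sim;
      A \<in> steps E sim; B \<in> steps E sim; A \<times> B \<subseteq> inl\<rbrakk>
    \<Longrightarrow> gct_rewrite E sim ser inl (w @ [A, B] @ z) (w @ [B, A] @ z)"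

definition gct_equiv ::
  "'a set \<Rightarrow> 'a rel \<Rightarrow> 'a rel \<Rightarrow> 'a rel \<Rightarrow> 'a set list \<Rightarrow> 'a set list \<Rightarrow> bool" where
  "gct_equiv E sim ser inl = equivclp (gct_rewrite E sim ser inl)"


section \<open>Event occurrences\<close>

text \<open>
  The occurrence \<open>e\<close> with superscript \<open>j\<close> is the pair \<open>(e, j)\<close>, with \<open>j \<ge> 1\<close>, so that the
  labelling \<open>l\<close> is \<^const>\<open>fst\<close>. Steps of a sequence are indexed from \<open>0\<close>; only the order of
  positions is ever used.
\<close>

type_synonym 'a occurrence = "'a \<times> nat"

definition enum_step :: "'a set list \<Rightarrow> nat \<Rightarrow> 'a occurrence set" where
  "enum_step s i = (\<lambda>e. (e, card {j. j < i \<and> e \<in> s ! j} + 1)) ` (s ! i)"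

definition occs :: "'a set list \<Rightarrow> 'a occurrence set" where
  "occs s = (\<Union>i<length s. enum_step s i)"

definition pos :: "'a set list \<Rightarrow> 'a occurrence \<Rightarrow> nat" where
  "pos s \<alpha> = (THE i. i < length s \<and> \<alpha> \<in> enum_step s i)"

definition lhd_rel :: "'a set list \<Rightarrow> 'a occurrence rel" where
  "lhd_rel s = {(\<alpha>, \<beta>) \<in> occs s \<times> occs s. pos s \<alpha> < pos s \<beta>}"

definition lhd_frown_rel :: "'a set list \<Rightarrow> 'a occurrence rel" where
  "lhd_frown_rel s = {(\<alpha>, \<beta>) \<in> occs s \<times> occs s. \<alpha> \<noteq> \<beta> \<and> pos s \<alpha> \<le> pos s \<beta>}"


section \<open>Closures of relational structures\<close>

text \<open>
  For \<open>R \<subseteq> X \<times> X\<close>, the library closure \<open>R\<^sup>*\<close> differs from the one taken on \<open>X\<close> only by diagonal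
  pairs outside \<open>X\<close>. Below it is always composed or intersected with relations on \<open>X\<close>, has the
  diagonal removed, or relates elements one of which is constrained to lie in \<open>X\<close>, so these
  pairs never matter.
\<close>

type_synonym 'b rel_struct = "'b set \<times> 'b rel \<times> 'b rel"

definition sym_part :: "'b rel \<Rightarrow> 'b rel" where
  "sym_part R = R \<inter> R\<inverse>"

definition sym_closure :: "'b rel \<Rightarrow> 'b rel" where
  "sym_closure R = R \<union> R\<inverse>"

definition clos_prec :: "'b rel \<Rightarrow> 'b rel \<Rightarrow> 'b rel" where
  "clos_prec R1 R2 = (R1 \<union> R2)\<^sup>* O R1 O (R1 \<union> R2)\<^sup>*"

definition clos_sqsub :: "'b rel \<Rightarrow> 'b rel \<Rightarrow> 'b rel" where
  "clos_sqsub R1 R2 = (R1 \<union> R2)\<^sup>* - Id"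

fun bowtie_closure :: "'b rel_struct \<Rightarrow> 'b rel_struct" where
  "bowtie_closure (X, R1, R2) =
    (let R3 = R1 \<inter> R2\<^sup>*
     in (X, sym_closure (clos_prec R3 R2) \<union> R1, clos_sqsub R3 R2))"


section \<open>The structure of a step sequence\<close>

definition inl_rel :: "'a rel \<Rightarrow> 'a set list \<Rightarrow> 'a occurrence rel" where
  "inl_rel inl s = {(\<alpha>, \<beta>) \<in> occs s \<times> occs s. (fst \<alpha>, fst \<beta>) \<in> inl}"

definition sqsub_rel :: "'a rel \<Rightarrow> 'a rel \<Rightarrow> 'a set list \<Rightarrow> 'a occurrence rel" where
  "sqsub_rel ser inl s =
    {(\<alpha>, \<beta>). (\<alpha>, \<beta>) \<in> lhd_frown_rel s \<and> (fst \<beta>, fst \<alpha>) \<notin> ser \<union> inl}"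

definition prec_rel :: "'a rel \<Rightarrow> 'a rel \<Rightarrow> 'a set list \<Rightarrow> 'a occurrence rel" where
  "prec_rel ser inl s =
    {(\<alpha>, \<beta>). (\<alpha>, \<beta>) \<in> lhd_rel s \<and>
      ((fst \<alpha>, fst \<beta>) \<notin> ser \<union> inl
       \<or> (\<alpha>, \<beta>) \<in> inl_rel inl s \<inter>
           (sym_part ((sqsub_rel ser inl s)\<^sup>*) O (occs s \<times> occs s - inl_rel inl s)
              O sym_part ((sqsub_rel ser inl s)\<^sup>*))
       \<or> (fst \<alpha>, fst \<beta>) \<in> ser \<and>
           (\<exists>\<delta>\<in>occs s. \<exists>\<gamma>\<in>occs s.
              (\<delta>, \<gamma>) \<in> lhd_rel s \<and> (fst \<delta>, fst \<gamma>) \<notin> ser \<and>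
              (\<alpha>, \<delta>) \<in> (sqsub_rel ser inl s)\<^sup>* \<and> (\<delta>, \<beta>) \<in> (sqsub_rel ser inl s)\<^sup>* \<and>
              (\<alpha>, \<gamma>) \<in> (sqsub_rel ser inl s)\<^sup>* \<and> (\<gamma>, \<beta>) \<in> (sqsub_rel ser inl s)\<^sup>*))}"

definition gstruct :: "'a rel \<Rightarrow> 'a rel \<Rightarrow> 'a set list \<Rightarrow> 'a occurrence rel_struct" where
  "gstruct ser inl s =
    bowtie_closure (occs s, prec_rel ser inl s \<union> inl_rel inl s,
                            prec_rel ser inl s \<union> sqsub_rel ser inl s)"

end

theory Submission
  imports Defs
begin

text \<open>
  A single rewrite reorders only occurrences whose labels are related by \<open>ser\<close> or \<open>inl\<close>, and it
  leaves even the generating relations \<open>\<prec>\<^sub>s\<close> and \<open>\<sqsubset>\<^sub>s\<close> unchanged; hence equivalent sequences have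
  the same structure.

  Conversely, serialize \<open>s\<close> and \<open>t\<close> as far as possible, so that every step is strongly connected
  under \<open>\<sqsubset>\<close>. The second relation of the structure determines \<open>(\<prec> \<union> \<sqsubset>)\<^sup>*\<close>, whose strongly
  connected components are then exactly the steps. So \<open>s\<close> and \<open>t\<close> consist of the same blocks in
  possibly different orders, and two adjacent blocks of \<open>s\<close> that are inverted in \<open>t\<close> are unrelated
  and can be swapped, which lowers the number of inversions.
\<close>

section \<open>Labelled steps\<close>

text \<open>The parameter \<open>c e\<close> counts the occurrences of \<open>e\<close> before the list; it makes concatenation tractable.\<close>

fun label_steps :: "('a \<Rightarrow> nat) \<Rightarrow> 'a set list \<Rightarrow> 'a occurrence set list" where
  "label_steps c [] = []"
| "label_steps c (A # s) = (\<lambda>e. (e, c e + 1)) ` A # label_steps (\<lambda>e. c e + of_bool (e \<in> A)) s"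

abbreviation occ_steps :: "'a set list \<Rightarrow> 'a occurrence set list" where
  "occ_steps \<equiv> label_steps (\<lambda>_. 0)"

lemma length_label_steps [simp]: "length (label_steps c s) = length s"
  by (induction s arbitrary: c) auto

lemma label_steps_append:
  "label_steps c (u @ v) = label_steps c u @ label_steps (\<lambda>e. c e + length (filter ((\<in>) e) u)) v"
  by (induction u arbitrary: c) (auto intro!: arg_cong2[where f = label_steps])

lemma image_fst_label_steps: "map (image fst) (label_steps c s) = s"
  by (induction s arbitrary: c) (auto simp: image_image)

lemma occ_steps_inject: "occ_steps s = occ_steps t \<longleftrightarrow> s = t"
  by (metis image_fst_label_steps)

lemma nth_label_steps:
  "i < length s \<Longrightarrow>
    label_steps c s ! i = (\<lambda>e. (e, c e + length (filter ((\<in>) e) (take i s)) + 1)) ` (s ! i)"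
proof (induction s arbitrary: c i)
  case (Cons A s)
  then show ?case by (cases i) (auto intro!: image_cong)
qed simp

lemma nth_occ_steps: "i < length s \<Longrightarrow> occ_steps s ! i = enum_step s i"
proof -
  assume i: "i < length s"
  have "length (filter ((\<in>) e) (take i s)) = card {j. j < i \<and> e \<in> s ! j}" for e
    using i by (auto simp: length_filter_conv_card intro!: arg_cong[where f = card])
  then show ?thesis using i by (simp add: nth_label_steps enum_step_def)
qed

text \<open>The superscript of \<open>e\<close> grows with each step containing \<open>e\<close>, so
  an occurrence determines its step. This makes the definite description in \<open>pos\<close> well
  defined.\<close>

lemma enum_step_disjoint:
  assumes "x \<in> enum_step s i" "x \<in> enum_step s j" shows "i = j"
proof -
  have False if "i < j" "x \<in> enum_step s i" "x \<in> enum_step s j" for i j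
  proof -
    from that obtain e where e: "e \<in> s ! i"
      "card {k. k < i \<and> e \<in> s ! k} = card {k. k < j \<and> e \<in> s ! k}"
      by (auto simp: enum_step_def)
    have "{k. k < i \<and> e \<in> s ! k} \<subset> {k. k < j \<and> e \<in> s ! k}"
      using e(1) \<open>i < j\<close> by auto
    then have "card {k. k < i \<and> e \<in> s ! k} < card {k. k < j \<and> e \<in> s ! k}"
      by (intro psubset_card_mono) auto
    then show False using e(2) by simp
  qed
  from this[of i j] this[of j i] assms show ?thesis by (cases i j rule: linorder_cases) auto
qed

lemma pos_eq: "i < length s \<Longrightarrow> x \<in> occ_steps s ! i \<Longrightarrow> pos s x = i"
  unfolding pos_def by (rule the_equality) (auto simp: nth_occ_steps dest: enum_step_disjoint)

lemma occs_iff: "x \<in> occs s \<longleftrightarrow> (\<exists>i<length s. x \<in> occ_steps s ! i)"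
  by (auto simp: occs_def nth_occ_steps)

lemma pos_less: "x \<in> occs s \<Longrightarrow> pos s x < length s"
  by (auto simp: occs_iff pos_eq)

lemma in_nth_occ_steps_iff: "i < length s \<Longrightarrow> x \<in> occ_steps s ! i \<longleftrightarrow> x \<in> occs s \<and> pos s x = i"
  by (auto simp: occs_iff pos_eq)

lemma in_set_occ_steps_iff:
  "(\<exists>A\<in>set (occ_steps s). P A) \<longleftrightarrow> (\<exists>i<length s. P (occ_steps s ! i))"
  by (metis in_set_conv_nth length_label_steps)

lemma occs_eq_Union: "occs s = \<Union> (set (occ_steps s))"
  by (rule set_eqI) (simp add: in_set_occ_steps_iff occs_iff)

section \<open>Relative order and simultaneity of occurrences\<close>

text \<open>Recursion on the list gives a rule for append, so the effect of a local rewrite can be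
  read off the block list.\<close>

fun before_rel :: "'b set list \<Rightarrow> 'b rel" where
  "before_rel [] = {}"
| "before_rel (A # L) = A \<times> \<Union> (set L) \<union> before_rel L"

definition together_rel :: "'b set list \<Rightarrow> 'b rel" where
  "together_rel L = (\<Union>A\<in>set L. A \<times> A)"

lemma before_rel_iff:
  "(x, y) \<in> before_rel L \<longleftrightarrow> (\<exists>i j. i < j \<and> j < length L \<and> x \<in> L ! i \<and> y \<in> L ! j)"
proof (induction L)
  case (Cons A L)
  have "(\<exists>i j. i < j \<and> j < length (A # L) \<and> x \<in> (A # L) ! i \<and> y \<in> (A # L) ! j) \<longleftrightarrow>
    (\<exists>j<length L. x \<in> A \<and> y \<in> L ! j) \<or> (\<exists>i j. i < j \<and> j < length L \<and> x \<in> L ! i \<and> y \<in> L ! j)"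
    (is "?l \<longleftrightarrow> ?r")
  proof
    assume ?l
    then obtain i j where "i < j" "j < length (A # L)" "x \<in> (A # L) ! i" "y \<in> (A # L) ! j" by blast
    then show ?r by (cases i; cases j) auto
  next
    assume ?r
    then show ?l
    proof
      assume "\<exists>j<length L. x \<in> A \<and> y \<in> L ! j"
      then obtain j where "j < length L" "x \<in> A" "y \<in> L ! j" by blast
      then show ?l by (intro exI[of _ 0] exI[of _ "Suc j"]) auto
    next
      assume "\<exists>i j. i < j \<and> j < length L \<and> x \<in> L ! i \<and> y \<in> L ! j"
      then obtain i j where "i < j" "j < length L" "x \<in> L ! i" "y \<in> L ! j" by blast
      then show ?l by (intro exI[of _ "Suc i"] exI[of _ "Suc j"]) auto
    qed
  qed
  moreover have "(\<exists>j<length L. x \<in> A \<and> y \<in> L ! j) \<longleftrightarrow> (x, y) \<in> A \<times> \<Union> (set L)"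
    by (fastforce simp: in_set_conv_nth)
  ultimately show ?case using Cons.IH by simp
qed simp

lemma before_rel_append:
  "before_rel (L @ M) = before_rel L \<union> \<Union> (set L) \<times> \<Union> (set M) \<union> before_rel M"
  by (induction L) auto

text \<open>Membership in block \<open>i\<close> forces \<open>i\<close> to be the position.
  \<open>P\<close> is left free to cover both \<open><\<close> and \<open>=\<close>.\<close>

lemma occ_steps_pairs_iff:
  "(\<exists>i j. P i j \<and> i < length s \<and> j < length s \<and> x \<in> occ_steps s ! i \<and> y \<in> occ_steps s ! j) \<longleftrightarrow>
    x \<in> occs s \<and> y \<in> occs s \<and> P (pos s x) (pos s y)"
    (is "?l \<longleftrightarrow> ?r")
proof
  assume ?l
  then obtain i j where "P i j" "i < length s" "j < length s" "x \<in> occ_steps s ! i" "y \<in> occ_steps s ! j"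
    by blast
  then show ?r by (simp add: in_nth_occ_steps_iff)
next
  assume ?r
  then show ?l by (intro exI[of _ "pos s x"] exI[of _ "pos s y"]) (simp add: in_nth_occ_steps_iff pos_less)
qed

lemma lhd_rel_eq: "lhd_rel s = before_rel (occ_steps s)"
proof -
  have "(x, y) \<in> before_rel (occ_steps s) \<longleftrightarrow> (x, y) \<in> lhd_rel s" for x y
  proof -
    have "(x, y) \<in> before_rel (occ_steps s) \<longleftrightarrow>
      (\<exists>i j. i < j \<and> i < length s \<and> j < length s \<and> x \<in> occ_steps s ! i \<and> y \<in> occ_steps s ! j)"
      unfolding before_rel_iff length_label_steps by (meson order.strict_trans)
    then show ?thesis unfolding occ_steps_pairs_iff lhd_rel_def by simp
  qed
  then show ?thesis by auto
qed

lemma lhd_rel_nth_occ_steps: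
  "i < j \<Longrightarrow> j < length s \<Longrightarrow> occ_steps s ! i \<times> occ_steps s ! j \<subseteq> lhd_rel s"
  unfolding lhd_rel_eq by (clarsimp simp: before_rel_iff) blast

lemma together_rel_iff:
  "(x, y) \<in> together_rel (occ_steps s) \<longleftrightarrow> x \<in> occs s \<and> y \<in> occs s \<and> pos s x = pos s y"
proof -
  have "(x, y) \<in> together_rel (occ_steps s) \<longleftrightarrow>
    (\<exists>i j. i = j \<and> i < length s \<and> j < length s \<and> x \<in> occ_steps s ! i \<and> y \<in> occ_steps s ! j)"
    by (auto simp: together_rel_def in_set_occ_steps_iff)
  then show ?thesis unfolding occ_steps_pairs_iff .
qed

lemma lhd_frown_rel_eq:
  "lhd_frown_rel s = before_rel (occ_steps s) \<union> together_rel (occ_steps s) - Id"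
  by (auto simp: lhd_frown_rel_def lhd_rel_eq[symmetric] together_rel_iff lhd_rel_def)

section \<open>Reachability and what the structure determines\<close>

text \<open>Each link weakly increases the position. Requiring \<open>x \<in> occs s\<close>
  discards reflexive pairs outside the occurrences.\<close>

lemma sqsub_rel_rtrancl:
  assumes "(x, y) \<in> (sqsub_rel ser inl s)\<^sup>*" and "x \<in> occs s"
  shows "y \<in> occs s \<and> pos s x \<le> pos s y"
  using assms by (induction rule: rtrancl_induct) (auto simp: sqsub_rel_def lhd_frown_rel_def)

lemma weak_rel_rtrancl:
  assumes "(x, y) \<in> (prec_rel ser inl s \<union> sqsub_rel ser inl s)\<^sup>*" and "x \<in> occs s"
  shows "y \<in> occs s \<and> pos s x \<le> pos s y"
  using assms
  by (induction rule: rtrancl_induct) (auto simp: sqsub_rel_def lhd_frown_rel_def prec_rel_def lhd_rel_def)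

lemma gstruct_eqD:
  assumes "gstruct ser inl s = gstruct ser inl t"
  shows "occs s = occs t"
    and "(prec_rel ser inl s \<union> sqsub_rel ser inl s)\<^sup>* = (prec_rel ser inl t \<union> sqsub_rel ser inl t)\<^sup>*"
proof -
  show "occs s = occs t" using assms by (simp add: gstruct_def Let_def)
  \<comment> \<open>In the closure \<open>R3\<close> lies inside \<open>R2\<^sup>*\<close>, so
    adding it to \<open>R2\<close> creates no new reachability.\<close>
  have absorb: "(R \<inter> S\<^sup>* \<union> S)\<^sup>* = S\<^sup>*" for R S :: "'b rel"
    by (rule rtrancl_subset) auto
  have "(prec_rel ser inl s \<union> sqsub_rel ser inl s)\<^sup>* - Id = (prec_rel ser inl t \<union> sqsub_rel ser inl t)\<^sup>* - Id"
    using assms unfolding gstruct_def bowtie_closure.simps Let_def clos_sqsub_def absorb by simp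
  moreover have "R\<^sup>* = R\<^sup>* - Id \<union> Id" for R :: "'b rel" by auto
  ultimately show "(prec_rel ser inl s \<union> sqsub_rel ser inl s)\<^sup>* = (prec_rel ser inl t \<union> sqsub_rel ser inl t)\<^sup>*"
    by metis
qed

section \<open>Invariance under rewriting\<close>

text \<open>The composed relation of clause (ii): the strongly connected components of the two
  occurrences contain a pair not related by \<open>inl\<close>.\<close>

definition inl_linked :: "'a rel \<Rightarrow> 'a rel \<Rightarrow> 'a set list \<Rightarrow> 'a occurrence rel" where
  "inl_linked ser inl s = sym_part ((sqsub_rel ser inl s)\<^sup>*) O (occs s \<times> occs s - inl_rel inl s)
              O sym_part ((sqsub_rel ser inl s)\<^sup>*)"

text \<open>
  Clause (iii) survives an interleaving that reverses its witnesses \<open>\<delta>\<close> and \<open>\<gamma>\<close>, because they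
  can exchange roles.
\<close>

lemma prec_rel_mono:
  assumes "ser \<inter> inl = {}" and "occs s = occs t" and "sqsub_rel ser inl s = sqsub_rel ser inl t"
    and flip: "\<And>\<delta> \<gamma>. (\<delta>, \<gamma>) \<in> lhd_rel s \<Longrightarrow> (\<delta>, \<gamma>) \<in> lhd_rel t \<or> (fst \<delta>, fst \<gamma>) \<in> ser \<or>
      (fst \<delta>, fst \<gamma>) \<in> inl \<and> (fst \<gamma>, fst \<delta>) \<notin> ser \<and> (\<gamma>, \<delta>) \<in> lhd_rel t \<and> (\<delta>, \<gamma>) \<notin> inl_linked ser inl s"
  shows "prec_rel ser inl s \<subseteq> prec_rel ser inl t"
proof clarify
  fix \<alpha> \<beta> assume prec: "(\<alpha>, \<beta>) \<in> prec_rel ser inl s"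
  let ?Q = "sqsub_rel ser inl t"
  have inl: "inl_rel inl s = inl_rel inl t" using assms(2) by (simp add: inl_rel_def)
  have lhd: "(\<alpha>, \<beta>) \<in> lhd_rel s" using prec by (auto simp: prec_rel_def)
  \<comment> \<open>The cases are clauses (i), (ii) and (iii); reachability in (iii) moves to
    \<open>t\<close> because \<open>sqsub_rel\<close> is shared.\<close>
  consider "(fst \<alpha>, fst \<beta>) \<notin> ser \<union> inl" | "(\<alpha>, \<beta>) \<in> inl_rel inl s" "(\<alpha>, \<beta>) \<in> inl_linked ser inl s"
    | \<delta> \<gamma> where "(fst \<alpha>, fst \<beta>) \<in> ser" "\<delta> \<in> occs s" "\<gamma> \<in> occs s" "(\<delta>, \<gamma>) \<in> lhd_rel s" "(fst \<delta>, fst \<gamma>) \<notin> ser"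
      "(\<alpha>, \<delta>) \<in> ?Q\<^sup>*" "(\<delta>, \<beta>) \<in> ?Q\<^sup>*" "(\<alpha>, \<gamma>) \<in> ?Q\<^sup>*" "(\<gamma>, \<beta>) \<in> ?Q\<^sup>*"
    using prec unfolding prec_rel_def assms(3) inl_linked_def[symmetric] mem_Collect_eq case_prod_conv Int_iff
    unfolding inl_linked_def assms(3) by (elim conjE disjE bexE) assumption+
  then show "(\<alpha>, \<beta>) \<in> prec_rel ser inl t"
  proof cases
    case 1
    then have "(\<alpha>, \<beta>) \<in> lhd_rel t" using flip[OF lhd] by blast
    then show ?thesis using 1 unfolding prec_rel_def by blast
  next
    case 2
    \<comment> \<open>Disjointness rules out \<open>ser\<close>, and the link itself rules out a
      reversal.\<close>
    then have "(\<alpha>, \<beta>) \<in> lhd_rel t" using flip[OF lhd] assms(1) by (auto simp: inl_rel_def)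
    then show ?thesis using 2 unfolding prec_rel_def inl_linked_def inl assms by blast
  next
    case 3
    obtain \<delta>' \<gamma>' where d: "\<delta>' \<in> occs t" "\<gamma>' \<in> occs t" "(\<delta>', \<gamma>') \<in> lhd_rel t" "(fst \<delta>', fst \<gamma>') \<notin> ser"
      "(\<alpha>, \<delta>') \<in> ?Q\<^sup>*" "(\<delta>', \<beta>) \<in> ?Q\<^sup>*" "(\<alpha>, \<gamma>') \<in> ?Q\<^sup>*" "(\<gamma>', \<beta>) \<in> ?Q\<^sup>*"
      using flip[OF 3(4)] 3 assms(2) by blast
    \<comment> \<open>In \<open>t\<close>, \<open>\<alpha>\<close> is no later than
      \<open>\<delta>'\<close>, which strictly precedes \<open>\<gamma>'\<close>, which is no later
      than \<open>\<beta>\<close>.\<close>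
    have "(\<alpha>, \<beta>) \<in> lhd_rel t"
      using d lhd assms(2) sqsub_rel_rtrancl[OF d(5)] sqsub_rel_rtrancl[OF d(8)] unfolding lhd_rel_def by auto
    then show ?thesis using 3(1) d unfolding prec_rel_def by blast
  qed
qed

section \<open>Effect of splitting and swapping blocks\<close>

text \<open>The occurrence that \<open>e\<close> receives in a step directly after \<open>w\<close>.
  Splitting or swapping disjoint blocks keeps these names.\<close>

definition next_occ :: "'a set list \<Rightarrow> 'a \<Rightarrow> 'a occurrence" where
  "next_occ w e = (e, length (filter ((\<in>) e) w) + 1)"

lemma fst_next_occ [simp]: "fst (next_occ w e) = e"
  by (simp add: next_occ_def)

lemma occ_steps_single:
  "occ_steps (w @ [A] @ z) = occ_steps w @ [next_occ w ` A] @
    label_steps (\<lambda>e. length (filter ((\<in>) e) w) + of_bool (e \<in> A)) z"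
  by (simp add: label_steps_append next_occ_def)

text \<open>By disjointness \<open>A\<close> raises no superscript in \<open>B\<close>, and the
  suffix depends only on \<open>A \<union> B\<close>, hence neither on the order nor on
  merging.\<close>

lemma occ_steps_pair:
  assumes "A \<inter> B = {}"
  shows "occ_steps (w @ [A, B] @ z) = occ_steps w @ [next_occ w ` A, next_occ w ` B] @
    label_steps (\<lambda>e. length (filter ((\<in>) e) w) + of_bool (e \<in> A \<union> B)) z"
proof -
  have "(\<lambda>e. n e + of_bool (e \<in> A) + of_bool (e \<in> B)) = (\<lambda>e. n e + of_bool (e \<in> A \<union> B))"
    for n :: "'a \<Rightarrow> nat"
    using assms by (auto simp: fun_eq_iff)
  moreover have "(\<lambda>e. (e, n e + of_bool (e \<in> A) + 1)) ` B = (\<lambda>e. (e, n e + 1)) ` B" for n :: "'a \<Rightarrow> nat"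
    using assms by (auto intro!: image_cong)
  ultimately show ?thesis
    unfolding next_occ_def by (simp add: label_steps_append del: Un_iff)
qed

lemma occs_serialize:
  assumes "B \<inter> C = {}"
  shows "occs (w @ [B, C] @ z) = occs (w @ [B \<union> C] @ z)"
  by (simp only: occs_eq_Union occ_steps_single occ_steps_pair[OF assms]) (auto simp: image_Un)

lemma lhd_rel_serialize:
  assumes "B \<inter> C = {}"
  shows "lhd_rel (w @ [B, C] @ z) = lhd_rel (w @ [B \<union> C] @ z) \<union> next_occ w ` B \<times> next_occ w ` C"
  by (simp only: lhd_rel_eq occ_steps_single occ_steps_pair[OF assms])
    (auto simp: before_rel_append image_Un)

lemma together_rel_serialize:
  assumes "B \<inter> C = {}"
  shows "together_rel (occ_steps (w @ [B \<union> C] @ z)) = together_rel (occ_steps (w @ [B, C] @ z)) \<union>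
    next_occ w ` B \<times> next_occ w ` C \<union> next_occ w ` C \<times> next_occ w ` B"
  by (simp only: together_rel_def occ_steps_single occ_steps_pair[OF assms]) (auto simp: image_Un)

lemma set_occ_steps_swap:
  assumes "A \<inter> B = {}"
  shows "set (occ_steps (w @ [B, A] @ z)) = set (occ_steps (w @ [A, B] @ z))"
  using assms by (simp only: occ_steps_pair Int_commute[of B A] Un_commute[of B A]) auto

lemma together_rel_swap:
  assumes "A \<inter> B = {}"
  shows "together_rel (occ_steps (w @ [B, A] @ z)) = together_rel (occ_steps (w @ [A, B] @ z))"
  by (simp only: together_rel_def set_occ_steps_swap[OF assms])

text \<open>Both orders are compared with the merged block \<open>A \<union> B\<close>. It may fail
  to be a legal step, but the identities for splitting ask only for disjointness.\<close>

lemma lhd_rel_swap: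
  assumes "A \<inter> B = {}"
  shows "lhd_rel (w @ [B, A] @ z) = lhd_rel (w @ [A, B] @ z) - next_occ w ` A \<times> next_occ w ` B
    \<union> next_occ w ` B \<times> next_occ w ` A"
proof -
  have eqs: "lhd_rel (w @ [A, B] @ z) = lhd_rel (w @ [A \<union> B] @ z) \<union> next_occ w ` A \<times> next_occ w ` B"
    "lhd_rel (w @ [B, A] @ z) = lhd_rel (w @ [A \<union> B] @ z) \<union> next_occ w ` B \<times> next_occ w ` A"
    using lhd_rel_serialize[OF assms] lhd_rel_serialize[of B A] assms by (simp_all add: Int_commute Un_commute)
  have "next_occ w ` A \<times> next_occ w ` B \<subseteq> together_rel (occ_steps (w @ [A \<union> B] @ z))"
    unfolding together_rel_serialize[OF assms] by blast
  then have "lhd_rel (w @ [A \<union> B] @ z) \<inter> next_occ w ` A \<times> next_occ w ` B = {}"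
    by (fastforce simp: together_rel_iff lhd_rel_def)
  then show ?thesis unfolding eqs by blast
qed

lemma together_relD:
  assumes "(x, y) \<in> together_rel (occ_steps s)" "X \<in> set (occ_steps s)" "x \<in> X"
  shows "y \<in> X"
  using assms by (auto simp: in_set_conv_nth together_rel_iff in_nth_occ_steps_iff)

text \<open>Positions increase weakly in both directions, hence agree: a strongly connected
  component never leaves its block.\<close>

lemma sym_part_sqsub_rel:
  assumes "(x, y) \<in> sym_part ((sqsub_rel ser inl s)\<^sup>*)" "x \<in> occs s"
  shows "(x, y) \<in> together_rel (occ_steps s)"
  using assms sqsub_rel_rtrancl[of x y] sqsub_rel_rtrancl[of y x]
  by (force simp: sym_part_def together_rel_iff)

lemma sym_part_weak_rel:
  assumes "(x, y) \<in> sym_part ((prec_rel ser inl s \<union> sqsub_rel ser inl s)\<^sup>*)" "x \<in> occs s"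
  shows "(x, y) \<in> together_rel (occ_steps s)"
  using assms weak_rel_rtrancl[of x y] weak_rel_rtrancl[of y x]
  by (force simp: sym_part_def together_rel_iff)

lemma gstruct_cong:
  assumes "occs s = occs t" "sqsub_rel ser inl s = sqsub_rel ser inl t" "prec_rel ser inl s = prec_rel ser inl t"
  shows "gstruct ser inl s = gstruct ser inl t"
  using assms by (simp add: gstruct_def inl_rel_def)

section \<open>Rewrites preserve the generating relations\<close>

text \<open>Stronger than equality of the closed structures: the reordering argument needs the
  generating relations themselves to survive a swap.\<close>

definition same_relations :: "'a rel \<Rightarrow> 'a rel \<Rightarrow> 'a set list \<Rightarrow> 'a set list \<Rightarrow> bool" where
  "same_relations ser inl s t \<longleftrightarrow> occs s = occs t \<and> sqsub_rel ser inl s = sqsub_rel ser inl t \<and>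
    prec_rel ser inl s = prec_rel ser inl t"

context gcomtrace_alphabet
begin

lemma ser_inl_disjoint: "ser \<inter> inl = {}"
  using ser_sim sim_inl_disjoint by blast

lemma ser_irrefl: "(a, a) \<notin> ser"
  using ser_sim irrefl_sim by (auto simp: irrefl_def)

lemma inl_irrefl: "(a, a) \<notin> inl"
  using irrefl_inl by (auto simp: irrefl_def)

lemma inl_commute: "(a, b) \<in> inl \<Longrightarrow> (b, a) \<in> inl"
  using sym_inl by (auto dest: symD)

lemma serialize_same_relations:
  assumes ser: "B \<times> C \<subseteq> ser"
  shows "same_relations ser inl (w @ [B \<union> C] @ z) (w @ [B, C] @ z)"
proof -
  let ?s = "w @ [B \<union> C] @ z" and ?t = "w @ [B, C] @ z"
  have disj: "B \<inter> C = {}" using ser ser_irrefl by blast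
  have occs: "occs ?s = occs ?t" using occs_serialize[OF disj] by metis
  have "lhd_frown_rel ?s = lhd_frown_rel ?t \<union> (next_occ w ` C \<times> next_occ w ` B - Id)"
    unfolding lhd_frown_rel_eq lhd_rel_eq[symmetric] lhd_rel_serialize[OF disj]
      together_rel_serialize[OF disj] by blast
  \<comment> \<open>A lost pair runs from \<open>C\<close> to \<open>B\<close>; its reversed labels
    lie in \<open>ser\<close>, so \<open>sqsub_rel\<close> never contained it.\<close>
  then have sqsub: "sqsub_rel ser inl ?s = sqsub_rel ser inl ?t"
    using ser unfolding sqsub_rel_def by auto
  have "prec_rel ser inl ?s \<subseteq> prec_rel ser inl ?t"
    by (rule prec_rel_mono[OF ser_inl_disjoint occs sqsub]) (use lhd_rel_serialize[OF disj] in blast)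
  moreover have "prec_rel ser inl ?t \<subseteq> prec_rel ser inl ?s"
  proof (rule prec_rel_mono[OF ser_inl_disjoint occs[symmetric] sqsub[symmetric]])
    fix \<delta> \<gamma> assume "(\<delta>, \<gamma>) \<in> lhd_rel ?t"
    then have "(\<delta>, \<gamma>) \<in> lhd_rel ?s \<or> (fst \<delta>, fst \<gamma>) \<in> ser"
      unfolding lhd_rel_serialize[OF disj] using ser by auto
    then show "(\<delta>, \<gamma>) \<in> lhd_rel ?s \<or> (fst \<delta>, fst \<gamma>) \<in> ser \<or>
      (fst \<delta>, fst \<gamma>) \<in> inl \<and> (fst \<gamma>, fst \<delta>) \<notin> ser \<and> (\<gamma>, \<delta>) \<in> lhd_rel ?s \<and> (\<delta>, \<gamma>) \<notin> inl_linked ser inl ?t"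
      by blast
  qed
  ultimately show ?thesis using occs sqsub by (simp add: same_relations_def)
qed

text \<open>\<open>occs\<close> and \<open>sqsub\<close> are hypotheses so that the reverse
  inclusion is this lemma with \<open>A\<close> and \<open>B\<close> exchanged.\<close>

lemma interleave_prec_rel_subset:
  assumes inl: "A \<times> B \<subseteq> inl"
    and occs: "occs (w @ [A, B] @ z) = occs (w @ [B, A] @ z)"
    and sqsub: "sqsub_rel ser inl (w @ [A, B] @ z) = sqsub_rel ser inl (w @ [B, A] @ z)"
  shows "prec_rel ser inl (w @ [A, B] @ z) \<subseteq> prec_rel ser inl (w @ [B, A] @ z)"
proof (rule prec_rel_mono[OF ser_inl_disjoint occs sqsub])
  let ?s = "w @ [A, B] @ z" and ?t = "w @ [B, A] @ z"
  have disj: "A \<inter> B = {}" using inl inl_irrefl by blast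
  have steps: "next_occ w ` A \<in> set (occ_steps ?s)" "next_occ w ` B \<in> set (occ_steps ?s)"
    unfolding occ_steps_pair[OF disj] by auto
  fix \<delta> \<gamma> assume lhd: "(\<delta>, \<gamma>) \<in> lhd_rel ?s"
  show "(\<delta>, \<gamma>) \<in> lhd_rel ?t \<or> (fst \<delta>, fst \<gamma>) \<in> ser \<or>
    (fst \<delta>, fst \<gamma>) \<in> inl \<and> (fst \<gamma>, fst \<delta>) \<notin> ser \<and> (\<gamma>, \<delta>) \<in> lhd_rel ?t \<and> (\<delta>, \<gamma>) \<notin> inl_linked ser inl ?s"
  proof (cases "(\<delta>, \<gamma>) \<in> next_occ w ` A \<times> next_occ w ` B")
    case True
    then have "(fst \<delta>, fst \<gamma>) \<in> inl" using inl by auto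
    moreover from this have "(fst \<gamma>, fst \<delta>) \<notin> ser" using inl_commute ser_inl_disjoint by blast
    moreover have "(\<gamma>, \<delta>) \<in> lhd_rel ?t" using True unfolding lhd_rel_swap[OF disj] by blast
    moreover have "(\<delta>, \<gamma>) \<notin> inl_linked ser inl ?s"
    proof
      assume "(\<delta>, \<gamma>) \<in> inl_linked ser inl ?s"
      then obtain \<delta>' \<gamma>' where link: "(\<delta>, \<delta>') \<in> sym_part ((sqsub_rel ser inl ?s)\<^sup>*)"
        "\<delta>' \<in> occs ?s" "\<gamma>' \<in> occs ?s" "(\<delta>', \<gamma>') \<notin> inl_rel inl ?s"
        "(\<gamma>', \<gamma>) \<in> sym_part ((sqsub_rel ser inl ?s)\<^sup>*)"
        unfolding inl_linked_def by blast
      \<comment> \<open>The partners stay in the blocks of \<open>\<delta>\<close> and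
        \<open>\<gamma>\<close>, where all label pairs are in \<open>inl\<close>.\<close>
      have "(\<delta>, \<delta>') \<in> together_rel (occ_steps ?s)"
        using sym_part_sqsub_rel[OF link(1)] lhd by (auto simp: lhd_rel_def)
      moreover have "(\<gamma>, \<gamma>') \<in> together_rel (occ_steps ?s)"
        using sym_part_sqsub_rel[OF link(5) link(3)] by (auto simp: together_rel_iff)
      ultimately have "\<delta>' \<in> next_occ w ` A" "\<gamma>' \<in> next_occ w ` B"
        using True together_relD steps by blast+
      then have "(fst \<delta>', fst \<gamma>') \<in> inl" using inl by auto
      then show False using link unfolding inl_rel_def by blast
    qed
    ultimately show ?thesis by blast
  next
    case False
    then show ?thesis using lhd unfolding lhd_rel_swap[OF disj] by blast
  qed
qed

lemma interleave_same_relations: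
  assumes inl: "A \<times> B \<subseteq> inl"
  shows "same_relations ser inl (w @ [A, B] @ z) (w @ [B, A] @ z)"
proof -
  let ?s = "w @ [A, B] @ z" and ?t = "w @ [B, A] @ z"
  have disj: "A \<inter> B = {}" using inl inl_irrefl by blast
  have inl': "B \<times> A \<subseteq> inl" using inl inl_commute by blast
  have occs: "occs ?s = occs ?t" unfolding occs_eq_Union set_occ_steps_swap[OF disj] ..
  have labels: "(fst \<alpha>, fst \<beta>) \<in> inl" "(fst \<beta>, fst \<alpha>) \<in> inl"
    if "(\<alpha>, \<beta>) \<in> next_occ w ` A \<times> next_occ w ` B" for \<alpha> \<beta>
    using that inl inl' by auto
  have sqsub: "sqsub_rel ser inl ?s = sqsub_rel ser inl ?t"
    unfolding sqsub_rel_def lhd_frown_rel_eq lhd_rel_eq[symmetric] lhd_rel_swap[OF disj] together_rel_swap[OF disj]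
    using labels by blast
  show ?thesis
    using interleave_prec_rel_subset[OF inl occs sqsub] interleave_prec_rel_subset[OF inl' occs[symmetric] sqsub[symmetric]]
      occs sqsub by (simp add: same_relations_def)
qed

lemma gct_equiv_same_relations:
  assumes "gct_equiv E sim ser inl s t"
  shows "same_relations ser inl s t"
proof -
  have rewrite: "same_relations ser inl u v" if "gct_rewrite E sim ser inl u v" for u v
    using that by cases (use serialize_same_relations interleave_same_relations in blast)+
  show ?thesis
    using assms unfolding gct_equiv_def
    by (induction rule: equivclp_induct) (use rewrite in \<open>auto simp: same_relations_def\<close>)
qed

section \<open>Reconstructing a step sequence\<close>

lemma split_nth_occ_steps:
  assumes "i < length s"
  obtains w A z where "s = w @ [A] @ z" "occ_steps s ! i = next_occ w ` A" "A = s ! i"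
  using that[of "take i s" "s ! i" "drop (Suc i) s"] assms
  by (simp add: id_take_nth_drop[symmetric] nth_label_steps next_occ_def)

lemma step_seqs_append [simp]:
  "u @ v \<in> step_seqs E sim \<longleftrightarrow> u \<in> step_seqs E sim \<and> v \<in> step_seqs E sim"
  by (simp add: step_seqs_def)

lemma step_seqs_Cons [simp]:
  "A # v \<in> step_seqs E sim \<longleftrightarrow> A \<in> steps E sim \<and> v \<in> step_seqs E sim"
  by (simp add: step_seqs_def)

lemma steps_subset: "A \<in> steps E sim \<Longrightarrow> B \<subseteq> A \<Longrightarrow> B \<noteq> {} \<Longrightarrow> B \<in> steps E sim"
  unfolding steps_def by blast

lemma finite_occs:
  assumes "s \<in> step_seqs E sim"
  shows "finite (occs s)"
proof -
  have "finite (s ! i)" if "i < length s" for i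
    using assms that finite_E finite_subset nth_mem[OF that]
    unfolding step_seqs_def steps_def lists_eq_set by blast
  then show ?thesis by (simp add: occs_def enum_step_def)
qed

lemma finite_together_rel: "s \<in> step_seqs E sim \<Longrightarrow> finite (together_rel (occ_steps s))"
  by (rule finite_subset[of _ "occs s \<times> occs s"]) (auto simp: together_rel_iff finite_occs)

lemma finite_lhd_rel: "s \<in> step_seqs E sim \<Longrightarrow> finite (lhd_rel s)"
  by (rule finite_subset[of _ "occs s \<times> occs s"]) (auto simp: lhd_rel_def finite_occs)

section \<open>Serializing as far as possible\<close>

lemma gct_equiv_trans:
  "gct_equiv E sim ser inl s t \<Longrightarrow> gct_equiv E sim ser inl t u \<Longrightarrow> gct_equiv E sim ser inl s u"
  unfolding gct_equiv_def by (rule equivclp_trans)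

lemma gct_equiv_sym: "gct_equiv E sim ser inl s t \<Longrightarrow> gct_equiv E sim ser inl t s"
  unfolding gct_equiv_def by (rule equivclp_sym)

lemma gct_equiv_serialize:
  assumes "w @ [B \<union> C] @ z \<in> step_seqs E sim" "B \<noteq> {}" "C \<noteq> {}" "B \<times> C \<subseteq> ser"
  shows "gct_equiv E sim ser inl (w @ [B \<union> C] @ z) (w @ [B, C] @ z)"
  unfolding gct_equiv_def using assms
  by (intro r_into_equivclp gct_rewrite.serialize) (auto intro: steps_subset)

text \<open>
  If \<open>x\<close> and \<open>y\<close> lie in a step and \<open>y\<close> is not reachable from \<open>x\<close>, everything reachable from
  \<open>x\<close> can be split off as the second part of that step.
\<close>

lemma exists_fully_serialized:
  assumes "s \<in> step_seqs E sim"
  shows "\<exists>t. gct_equiv E sim ser inl s t \<and> t \<in> step_seqs E sim \<and>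
    (\<forall>X\<in>set (occ_steps t). X \<times> X \<subseteq> (sqsub_rel ser inl t)\<^sup>*)"
  using assms
\<comment> \<open>The measure counts simultaneous pairs; splitting a block separates at least
  one.\<close>
proof (induction "card (together_rel (occ_steps s))" arbitrary: s rule: less_induct)
  case less
  let ?Q = "sqsub_rel ser inl s"
  show ?case
  proof (cases "\<forall>X\<in>set (occ_steps s). X \<times> X \<subseteq> ?Q\<^sup>*")
    case True
    then show ?thesis using less.prems unfolding gct_equiv_def by (auto intro: equivclp_refl)
  next
    case False
    then obtain i x y where i: "i < length s" "x \<in> occ_steps s ! i" "y \<in> occ_steps s ! i" "(x, y) \<notin> ?Q\<^sup>*"
      unfolding in_set_conv_nth length_label_steps Ball_def by blast
    obtain w A z where A: "s = w @ [A] @ z" "occ_steps s ! i = next_occ w ` A"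
      using split_nth_occ_steps[OF i(1)] by metis
    define C where "C = {e \<in> A. (x, next_occ w e) \<in> ?Q\<^sup>*}"
    define B where "B = A - C"
    have BC: "A = B \<union> C" "B \<inter> C = {}" unfolding B_def C_def by auto
    \<comment> \<open>The label of \<open>y\<close> lies in \<open>B\<close>, that of
      \<open>x\<close> in \<open>C\<close> by reflexivity.\<close>
    have ne: "B \<noteq> {}" "C \<noteq> {}" using i A unfolding B_def C_def by auto
    have ser: "B \<times> C \<subseteq> ser"
    proof clarify
      fix b c assume bc: "b \<in> B" "c \<in> C"
      then have "b \<in> A" "c \<in> A" "b \<noteq> c" using BC by auto
      then have "(b, c) \<in> sim" using less.prems A(1) by (auto simp: steps_def)
      then have "(b, c) \<notin> inl" using sim_inl_disjoint by blast
      \<comment> \<open>A link from \<open>c\<close> to \<open>b\<close> would put \<open>b\<close>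
        into \<open>C\<close>. As the two are simultaneous, only \<open>ser\<close> or
        \<open>inl\<close> can prevent the link, and \<open>inl\<close> is already excluded.\<close>
      moreover have "(next_occ w c, next_occ w b) \<notin> ?Q"
        using bc unfolding B_def C_def by (auto dest: rtrancl.rtrancl_into_rtrancl)
      moreover have "(next_occ w c, next_occ w b) \<in> lhd_frown_rel s"
      proof -
        have "next_occ w c \<in> occ_steps s ! i" "next_occ w b \<in> occ_steps s ! i"
          using \<open>b \<in> A\<close> \<open>c \<in> A\<close> A(2) by auto
        moreover have "next_occ w c \<noteq> next_occ w b" using \<open>b \<noteq> c\<close> by (metis fst_next_occ)
        ultimately show ?thesis using i(1) by (simp add: lhd_frown_rel_def in_nth_occ_steps_iff)
      qed
      ultimately show "(b, c) \<in> ser" by (simp add: sqsub_rel_def)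
    qed
    let ?t = "w @ [B, C] @ z"
    have equiv: "gct_equiv E sim ser inl s ?t"
      using gct_equiv_serialize[of w B C z] ne ser less.prems A(1) BC(1) by simp
    have t: "?t \<in> step_seqs E sim"
      using less.prems A(1) BC ne by (auto intro: steps_subset)
    obtain b c where bc: "b \<in> B" "c \<in> C" using ne by blast
    have "(next_occ w b, next_occ w c) \<notin> together_rel (occ_steps ?t)"
    proof -
      have "(next_occ w b, next_occ w c) \<in> lhd_rel ?t" using bc unfolding lhd_rel_serialize[OF BC(2)] by blast
      then show ?thesis by (auto simp: lhd_rel_def together_rel_iff)
    qed
    then have "together_rel (occ_steps ?t) \<subset> together_rel (occ_steps s)"
      using bc unfolding A(1) BC(1) together_rel_serialize[OF BC(2)] by blast
    then have "card (together_rel (occ_steps ?t)) < card (together_rel (occ_steps s))"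
      using finite_together_rel[OF less.prems] by (rule psubset_card_mono[rotated])
    from less.hyps[OF this t] equiv show ?thesis using gct_equiv_trans by blast
  qed
qed

section \<open>Reordering blocks by adjacent swaps\<close>

lemma distinct_occ_steps:
  assumes "s \<in> step_seqs E sim"
  shows "distinct (occ_steps s)"
proof -
  have "occ_steps s ! i \<noteq> {}" if "i < length s" for i
    using assms that nth_mem[OF that]
    by (auto simp: nth_label_steps step_seqs_def steps_def in_lists_conv_set)
  then show ?thesis
    unfolding distinct_conv_nth by (metis all_not_in_conv length_label_steps pos_eq)
qed

text \<open>Replacing each entry of \<open>xs\<close> by its index in \<open>ys\<close> gives a list
  with an adjacent descent unless it is sorted. Sorted, it would be the increasing list of all
  indices, forcing \<open>xs = ys\<close>.\<close>

lemma exists_adjacent_inversion: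
  assumes "distinct xs" "distinct ys" "set xs = set ys" "xs \<noteq> ys"
  obtains i j k where "Suc i < length xs" "xs ! i = ys ! k" "xs ! Suc i = ys ! j" "j < k" "k < length ys"
proof -
  define f where "f x = (THE i. i < length ys \<and> ys ! i = x)" for x
  have f_nth: "f (ys ! i) = i" if "i < length ys" for i
    unfolding f_def using that assms(2) by (intro the_equality) (auto simp: nth_eq_iff_index_eq)
  have f: "f x < length ys \<and> ys ! f x = x" if "x \<in> set xs" for x
    using that f_nth unfolding assms(3) by (auto simp: in_set_conv_nth)
  then have inj: "inj_on f (set xs)" by (metis inj_onI)
  have "\<not> sorted (map f xs)"
  proof
    assume "sorted (map f xs)"
    moreover have "map f ys = [0..<length ys]" by (rule nth_equalityI) (auto simp: f_nth)
    moreover have "set (map f xs) = set (map f ys)" by (simp add: assms(3))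
    moreover have "distinct (map f xs)" "distinct (map f ys)"
      using assms(1-3) inj by (simp_all add: distinct_map)
    ultimately have "map f xs = map f ys"
      by (intro sorted_distinct_set_unique) (simp_all only: sorted_upt)
    then show False using inj assms(3,4) by (simp add: inj_on_map_eq_map)
  qed
  then obtain i where i: "Suc i < length xs" "f (xs ! Suc i) < f (xs ! i)"
    by (auto simp: sorted_iff_nth_Suc)
  then show ?thesis using that[of i "f (xs ! i)" "f (xs ! Suc i)"] f[of "xs ! i"] f[of "xs ! Suc i"] by auto
qed

text \<open>
  Two adjacent blocks of \<open>s\<close> that \<open>t\<close> orders the other way are not related by the structure,
  so all their labels commute, either by \<open>inl\<close> or by \<open>ser\<close> in both directions; clause (ii) of
  the definition of \<open>prec_rel\<close> excludes a mixture.
\<close>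

lemma gct_equiv_reorder:
  assumes "s \<in> step_seqs E sim" "t \<in> step_seqs E sim" "set (occ_steps s) = set (occ_steps t)"
    and "\<forall>X\<in>set (occ_steps s). X \<times> X \<subseteq> (sqsub_rel ser inl s)\<^sup>*"
    and "(prec_rel ser inl s \<union> sqsub_rel ser inl s) \<inter> (lhd_rel t)\<inverse> = {}"
  shows "gct_equiv E sim ser inl s t"
  using assms
\<comment> \<open>The measure counts the pairs ordered by \<open>s\<close> that \<open>t\<close>
  does not order the same way.\<close>
proof (induction "card (lhd_rel s - lhd_rel t)" arbitrary: s rule: less_induct)
  case less
  note s = less.prems(1) and weak = less.prems(5)
  show ?case
  proof (cases "s = t")
    case True
    then show ?thesis unfolding gct_equiv_def by (auto intro: equivclp_refl)
  next
    case False
    then have "occ_steps s \<noteq> occ_steps t" by (simp add: occ_steps_inject)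
    from exists_adjacent_inversion[OF distinct_occ_steps[OF s] distinct_occ_steps[OF less.prems(2)] less.prems(3) this]
    obtain i j k where "Suc i < length (occ_steps s)" and jk: "occ_steps s ! i = occ_steps t ! k"
      "occ_steps s ! Suc i = occ_steps t ! j" "j < k" "k < length (occ_steps t)" .
    then have i: "Suc i < length s" by simp
    define A B where "A = s ! i" and "B = s ! Suc i"
    obtain w z where wz: "s = w @ [A, B] @ z" and len: "length w = i"
    proof
      show "length (take i s) = i" using i by simp
      show "s = take i s @ [A, B] @ drop (Suc (Suc i)) s"
        using i Cons_nth_drop_Suc[of i s] Cons_nth_drop_Suc[of "Suc i" s] append_take_drop_id[of i s]
        by (simp add: A_def B_def)
    qed
    let ?A = "occ_steps s ! i" and ?B = "occ_steps s ! Suc i"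
    have labels: "fst ` ?A = A" "fst ` ?B = B"
      using i by (auto simp: A_def B_def nth_label_steps image_image)
    have lhd_t: "?B \<times> ?A \<subseteq> lhd_rel t"
      using lhd_rel_nth_occ_steps[of j k t] jk by simp
    have lhd_s: "?A \<times> ?B \<subseteq> lhd_rel s"
      using lhd_rel_nth_occ_steps[of i "Suc i" s] i by simp
    \<comment> \<open>\<open>t\<close> puts \<open>?B\<close> before \<open>?A\<close>, so it would
      reverse any such relation.\<close>
    have unrelated: "(\<alpha>, \<beta>) \<notin> prec_rel ser inl s" "(\<alpha>, \<beta>) \<notin> sqsub_rel ser inl s"
      if "\<alpha> \<in> ?A" "\<beta> \<in> ?B" for \<alpha> \<beta>
      using weak lhd_t that by blast+
    \<comment> \<open>Otherwise clause (i) would put the pair into \<open>prec_rel\<close>. For the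
      reversed labels in \<open>bwd\<close>, \<open>sqsub_rel\<close> gives the
      contradiction.\<close>
    have fwd: "(fst \<alpha>, fst \<beta>) \<in> ser \<union> inl" if "\<alpha> \<in> ?A" "\<beta> \<in> ?B" for \<alpha> \<beta>
      using unrelated(1)[OF that] lhd_s that unfolding prec_rel_def by blast
    have bwd: "(fst \<beta>, fst \<alpha>) \<in> ser \<union> inl" if "\<alpha> \<in> ?A" "\<beta> \<in> ?B" for \<alpha> \<beta>
    proof -
      have "(\<alpha>, \<beta>) \<in> lhd_frown_rel s" using lhd_s that by (fastforce simp: lhd_rel_def lhd_frown_rel_def)
      then show ?thesis using unrelated(2)[OF that] unfolding sqsub_rel_def by blast
    qed
    have fwd': "A \<times> B \<subseteq> ser \<union> inl" and bwd': "B \<times> A \<subseteq> ser \<union> inl"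
      unfolding labels[symmetric] using fwd bwd by blast+
    have disj: "A \<inter> B = {}" using fwd' ser_irrefl inl_irrefl by blast
    have AB: "A \<in> steps E sim" "B \<in> steps E sim" "w \<in> step_seqs E sim" "z \<in> step_seqs E sim"
      using s unfolding wz by auto
    let ?s' = "w @ [B, A] @ z"
    have s': "?s' \<in> step_seqs E sim" using AB by simp
    have equiv: "gct_equiv E sim ser inl s ?s'"
    proof (cases "A \<times> B \<inter> inl = {}")
      case True
      then have ser: "A \<times> B \<subseteq> ser" "B \<times> A \<subseteq> ser" using fwd' bwd' inl_commute by blast+
      \<comment> \<open>With \<open>ser\<close> in both directions the blocks merge into a legal
        step, which splits again in the opposite order.\<close>
      have "A \<union> B \<in> steps E sim"
      proof -
        have "A \<times> B \<union> B \<times> A \<subseteq> sim" using ser ser_sim by blast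
        then show ?thesis using AB(1,2) by (auto simp: steps_def)
      qed
      then have step: "w @ [A \<union> B] @ z \<in> step_seqs E sim" using AB by simp
      have ne: "A \<noteq> {}" "B \<noteq> {}" using AB by (auto simp: steps_def)
      have "gct_equiv E sim ser inl (w @ [A \<union> B] @ z) s"
        unfolding wz by (rule gct_equiv_serialize[OF step ne ser(1)])
      moreover have "gct_equiv E sim ser inl (w @ [A \<union> B] @ z) ?s'"
        using gct_equiv_serialize[of w B A z] step ne ser(2) unfolding Un_commute[of B A] by blast
      ultimately show ?thesis using gct_equiv_sym gct_equiv_trans by blast
    next
      case False
      then obtain \<alpha> \<beta> where ab: "\<alpha> \<in> ?A" "\<beta> \<in> ?B" "(fst \<alpha>, fst \<beta>) \<in> inl"
        unfolding labels[symmetric] by blast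
      \<comment> \<open>As each block is strongly connected, a pair outside \<open>inl\<close> would
        link \<open>\<alpha>\<close> and \<open>\<beta>\<close>, and clause (ii) would relate
        them.\<close>
      have "(fst \<alpha>', fst \<beta>') \<in> inl" if "\<alpha>' \<in> ?A" "\<beta>' \<in> ?B" for \<alpha>' \<beta>'
      proof (rule ccontr)
        assume "(fst \<alpha>', fst \<beta>') \<notin> inl"
        moreover have "\<alpha> \<in> occs s" "\<alpha>' \<in> occs s" "\<beta> \<in> occs s" "\<beta>' \<in> occs s"
          using lhd_s ab that unfolding lhd_rel_def by blast+
        moreover have "?A \<times> ?A \<subseteq> (sqsub_rel ser inl s)\<^sup>*" "?B \<times> ?B \<subseteq> (sqsub_rel ser inl s)\<^sup>*"
          using less.prems(4) i by simp_all
        ultimately have "(\<alpha>, \<alpha>') \<in> sym_part ((sqsub_rel ser inl s)\<^sup>*)" "(\<beta>', \<beta>) \<in> sym_part ((sqsub_rel ser inl s)\<^sup>*)"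
          "(\<alpha>', \<beta>') \<in> occs s \<times> occs s - inl_rel inl s" "(\<alpha>, \<beta>) \<in> inl_rel inl s"
          using ab that unfolding inl_rel_def sym_part_def by auto
        then have "(\<alpha>, \<beta>) \<in> inl_rel inl s" "(\<alpha>, \<beta>) \<in> inl_linked ser inl s"
          unfolding inl_linked_def by blast+
        then have "(\<alpha>, \<beta>) \<in> prec_rel ser inl s"
          using lhd_s ab unfolding prec_rel_def inl_linked_def by blast
        then show False using unrelated ab by blast
      qed
      then have "A \<times> B \<subseteq> inl" unfolding labels[symmetric] by auto
      then show ?thesis
        unfolding gct_equiv_def wz using AB by (intro r_into_equivclp gct_rewrite.interleave)
    qed
    have same: "prec_rel ser inl ?s' = prec_rel ser inl s" "sqsub_rel ser inl ?s' = sqsub_rel ser inl s"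
      using gct_equiv_same_relations[OF equiv] by (simp_all add: same_relations_def)
    have blocks: "set (occ_steps ?s') = set (occ_steps s)"
      using set_occ_steps_swap[OF disj] unfolding wz .
    have nexts: "?A = next_occ w ` A" "?B = next_occ w ` B"
      unfolding wz occ_steps_pair[OF disj] len[symmetric] by (simp_all add: nth_append)
    have "lhd_rel ?s' = lhd_rel s - ?A \<times> ?B \<union> ?B \<times> ?A"
      using lhd_rel_swap[OF disj] unfolding nexts unfolding wz .
    moreover have "?A \<times> ?B \<inter> lhd_rel t = {}"
      using lhd_t unfolding lhd_rel_def by fastforce
    moreover have "?A \<times> ?B \<noteq> {}"
      using AB labels by (auto simp: steps_def)
    \<comment> \<open>The removed pairs were counted, since \<open>t\<close> has the opposite order;
      the new ones agree with \<open>t\<close>.\<close>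
    ultimately have "lhd_rel ?s' - lhd_rel t \<subset> lhd_rel s - lhd_rel t"
      using lhd_s lhd_t by blast
    then have "card (lhd_rel ?s' - lhd_rel t) < card (lhd_rel s - lhd_rel t)"
      using finite_lhd_rel[OF s] by (intro psubset_card_mono) auto
    from less.hyps[OF this s' less.prems(2)] have "gct_equiv E sim ser inl ?s' t"
      using less.prems(3,4,5) unfolding same blocks by blast
    with equiv show ?thesis by (rule gct_equiv_trans)
  qed
qed

section \<open>Recovering the blocks from the structure\<close>

text \<open>Full serialization makes a block mutually reachable, and mutual reachability forces
  equal positions. The right-hand side uses only the closure that \<open>gstruct\<close>
  determines.\<close>

lemma fully_serialized_block:
  assumes "\<forall>X\<in>set (occ_steps s). X \<times> X \<subseteq> (sqsub_rel ser inl s)\<^sup>*" "X \<in> set (occ_steps s)" "x \<in> X"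
  shows "X = {y. (x, y) \<in> sym_part ((prec_rel ser inl s \<union> sqsub_rel ser inl s)\<^sup>*)}"
proof -
  have "(sqsub_rel ser inl s)\<^sup>* \<subseteq> (prec_rel ser inl s \<union> sqsub_rel ser inl s)\<^sup>*"
    by (rule rtrancl_mono) blast
  then have "X \<times> X \<subseteq> sym_part ((prec_rel ser inl s \<union> sqsub_rel ser inl s)\<^sup>*)"
    using assms(1,2) unfolding sym_part_def by blast
  moreover have "x \<in> occs s" using assms(2,3) by (auto simp: occs_eq_Union)
  ultimately show ?thesis
    using assms(2,3) sym_part_weak_rel[of x _ ser inl s] together_relD[of x _ s X] by blast
qed

lemma fully_serialized_blocks_subset:
  assumes "s \<in> step_seqs E sim"
    and "\<forall>X\<in>set (occ_steps s). X \<times> X \<subseteq> (sqsub_rel ser inl s)\<^sup>*"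
    and "\<forall>X\<in>set (occ_steps t). X \<times> X \<subseteq> (sqsub_rel ser inl t)\<^sup>*"
    and eq: "gstruct ser inl s = gstruct ser inl t"
  shows "set (occ_steps s) \<subseteq> set (occ_steps t)"
proof
  fix X assume X: "X \<in> set (occ_steps s)"
  have "A \<noteq> {}" if "A \<in> set s" for A
    using assms(1) that by (auto simp: step_seqs_def steps_def)
  then have "X \<noteq> {}"
    using X image_fst_label_steps[of "\<lambda>_. 0" s] by (metis image_eqI image_is_empty set_map)
  then obtain x where x: "x \<in> X" by blast
  then have "x \<in> occs t" using X gstruct_eqD(1)[OF eq] by (auto simp: occs_eq_Union)
  then obtain Y where Y: "Y \<in> set (occ_steps t)" "x \<in> Y" by (auto simp: occs_eq_Union)
  \<comment> \<open>Both are the component of \<open>x\<close> under the same closure.\<close>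
  have "X = Y"
    using fully_serialized_block[OF assms(2) X x] fully_serialized_block[OF assms(3) Y] gstruct_eqD(2)[OF eq] by simp
  with Y show "X \<in> set (occ_steps t)" by simp
qed

lemma gct_equiv_if_gstruct_eq_fully_serialized:
  assumes "s \<in> step_seqs E sim" "t \<in> step_seqs E sim"
    and ser: "\<forall>X\<in>set (occ_steps s). X \<times> X \<subseteq> (sqsub_rel ser inl s)\<^sup>*"
      "\<forall>X\<in>set (occ_steps t). X \<times> X \<subseteq> (sqsub_rel ser inl t)\<^sup>*"
    and eq: "gstruct ser inl s = gstruct ser inl t"
  shows "gct_equiv E sim ser inl s t"
proof (rule gct_equiv_reorder)
  show "set (occ_steps s) = set (occ_steps t)"
    using fully_serialized_blocks_subset assms by (metis subset_antisym)
  show "(prec_rel ser inl s \<union> sqsub_rel ser inl s) \<inter> (lhd_rel t)\<inverse> = {}"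
  proof -
    \<comment> \<open>A generating pair of \<open>s\<close> lies in the closure shared with
      \<open>t\<close>, and that closure respects positions in \<open>t\<close>.\<close>
    have "pos t x \<le> pos t y" if "(x, y) \<in> prec_rel ser inl s \<union> sqsub_rel ser inl s" "x \<in> occs t" for x y
      using r_into_rtrancl[OF that(1)] weak_rel_rtrancl that(2) unfolding gstruct_eqD(2)[OF eq] by blast
    then show ?thesis by (fastforce simp: lhd_rel_def)
  qed
qed (use assms in auto)

lemma gstruct_eq_if_gct_equiv:
  "gct_equiv E sim ser inl s t \<Longrightarrow> gstruct ser inl s = gstruct ser inl t"
  using gct_equiv_same_relations by (auto simp: same_relations_def intro: gstruct_cong)

text \<open>Both sequences are replaced by fully serialized equivalents, whose structures still
  agree by the invariance already shown.\<close>

lemma gct_equiv_if_gstruct_eq: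
  assumes "s \<in> step_seqs E sim" "t \<in> step_seqs E sim" "gstruct ser inl s = gstruct ser inl t"
  shows "gct_equiv E sim ser inl s t"
proof -
  obtain s' where s': "gct_equiv E sim ser inl s s'" "s' \<in> step_seqs E sim"
    "\<forall>X\<in>set (occ_steps s'). X \<times> X \<subseteq> (sqsub_rel ser inl s')\<^sup>*"
    using exists_fully_serialized[OF assms(1)] by blast
  obtain t' where t': "gct_equiv E sim ser inl t t'" "t' \<in> step_seqs E sim"
    "\<forall>X\<in>set (occ_steps t'). X \<times> X \<subseteq> (sqsub_rel ser inl t')\<^sup>*"
    using exists_fully_serialized[OF assms(2)] by blast
  have "gstruct ser inl s' = gstruct ser inl t'"
    using gstruct_eq_if_gct_equiv[OF s'(1)] gstruct_eq_if_gct_equiv[OF t'(1)] assms(3) by simp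
  then have "gct_equiv E sim ser inl s' t'"
    by (rule gct_equiv_if_gstruct_eq_fully_serialized[OF s'(2) t'(2) s'(3) t'(3)])
  then show ?thesis using s'(1) t'(1) gct_equiv_sym gct_equiv_trans by blast
qed

end

theorem theorem11p3:
  fixes E :: "'a set" and sim ser inl :: "'a rel" and s t :: "'a set list"
  assumes "gcomtrace_alphabet E sim ser inl"
    and "s \<in> step_seqs E sim" and "t \<in> step_seqs E sim"
  shows "gct_equiv E sim ser inl s t \<longleftrightarrow> gstruct ser inl s = gstruct ser inl t"
  using gcomtrace_alphabet.gstruct_eq_if_gct_equiv[OF assms(1)]
    gcomtrace_alphabet.gct_equiv_if_gstruct_eq[OF assms] by blast

end
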